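(* (Simson's Theorem) Assume $P$ does not lie on $\iota(l_\infty)$. If $R_1$ is an ordinary point lying on the circumconic $\tilde{\mathcal{C}}_O$, then the `feet' $D_1,E_1,F_1$ of the parallels dropped to $BC,AC,AB$ from $R_1$ in the directions $QD,QE,QF$, respectively, are collinear.
   Context: We work in the Euclidean plane extended by its line at infinity $l_\infty$; points not on $l_\infty$ are called ordinary. $ABC$ is an ordinary non-degenerate triangle; its sides are the lines $BC, CA, AB$. $X_1X_2\cdot Y_1Y_2$ denotes the intersection of two lines. $K$ is the complement map (homothety with center the centroid $G$ and ratio $-1/2$); $K^{-1}(ABC)$ is the anticomplementary triangle. $\iota$ is the isotomic map, $(x:y:z)\mapsto(1/x:1/y:1/z)$ in barycentric coordinates; $\iota(l_\infty)$ is the Steiner circumellipse. $P$ is a point not on the sides of $ABC$ or $K^{-1}(ABC)$; $P'=\iota(P)$, $Q=K(P')$ (ordinary when $P\notin\iota(l_\infty)$), $D=AP\cdot BC$, $E=BP\cdot CA$, $F=CP\cdot AB$, and $D_3E_3F_3$ is the cevian triangle of $P'$. The foot $D_1$ is the intersection with $BC$ of the line through $R_1$ parallel to $QD$; $E_1$, $F_1$ are defined analogously on $AC$ (direction $QE$) and $AB$ (direction $QF$). The circumconic $\tilde{\mathcal{C}}_O$: let $T_{P'}$ be the affine map taking $A,B,C$ to $D_3,E_3,F_3$, and let $\mathcal{N}_{P'}$ be the nine-point conic of the quadrangle $ABCP'$ with respect to $l_\infty$, i.e. the locus of poles of $l_\infty$ (centers) with respect to the conics through $A,B,C,P'$; it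 passes through the diagonal points $D_3,E_3,F_3$ and through the midpoints of the six sides of the quadrangle. Then $\tilde{\mathcal{C}}_O=T_{P'}^{-1}(\mathcal{N}_{P'})$; it is a conic through $A,B,C$ with center $O=T_{P'}^{-1}(K(Q))$, which is the generalized circumcenter of $P$. *)

theory Defs
  imports "HOL-Analysis.Analysis"
begin

text \<open>
  The extended plane in homogeneous coordinates. A nonzero vector of \<^typ>\<open>real^3\<close> represents a
  point, a nonzero vector also represents a line (covector), and representatives are unique up to
  a nonzero factor. The zero vector represents nothing.
\<close>

definition hom :: "real^2 \<Rightarrow> real^3" where
  "hom X = vector [X $ 1, X $ 2, 1]"

text \<open>The affine point represented by \<open>p\<close>; meaningful only if \<open>p\<close> is ordinary.\<close>

definition aff :: "real^3 \<Rightarrow> real^2" where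
  "aff p = vector [p $ 1 / p $ 3, p $ 2 / p $ 3]"

definition linf :: "real^3" where
  "linf = vector [0, 0, 1]"

definition on :: "real^3 \<Rightarrow> real^3 \<Rightarrow> bool" where
  "on p l \<longleftrightarrow> p \<bullet> l = 0"

definition same_point :: "real^3 \<Rightarrow> real^3 \<Rightarrow> bool" where
  "same_point p q \<longleftrightarrow> p \<noteq> 0 \<and> q \<noteq> 0 \<and> (\<exists>c. q = c *\<^sub>R p)"

text \<open>\<open>join\<close> is a line if the two points are distinct, \<open>meet\<close> is a point if the two lines are.\<close>

definition join :: "real^3 \<Rightarrow> real^3 \<Rightarrow> real^3" where
  "join p q = cross3 p q"

definition meet :: "real^3 \<Rightarrow> real^3 \<Rightarrow> real^3" where
  "meet l m = cross3 l m"

definition parallel_through :: "real^3 \<Rightarrow> real^3 \<Rightarrow> real^3" where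
  "parallel_through p l = join p (meet l linf)"

definition on_sides :: "real^3 \<Rightarrow> real^3 \<Rightarrow> real^3 \<Rightarrow> real^3 \<Rightarrow> bool" where
  "on_sides p a b c \<longleftrightarrow> on p (join b c) \<or> on p (join c a) \<or> on p (join a b)"

text \<open>On ordinary points \<open>X \<mapsto> Z + k (X - Z)\<close>; points at infinity are fixed (if \<open>k \<noteq> 0\<close>).\<close>

definition homothety :: "real^2 \<Rightarrow> real \<Rightarrow> real^3 \<Rightarrow> real^3" where
  "homothety Z k p = k *\<^sub>R p + ((1 - k) * p $ 3) *\<^sub>R hom Z"

definition centroid :: "real^2 \<Rightarrow> real^2 \<Rightarrow> real^2 \<Rightarrow> real^2" where
  "centroid A B C = (1 / 3) *\<^sub>R (A + B + C)"

definition complement_map :: "real^2 \<Rightarrow> real^2 \<Rightarrow> real^2 \<Rightarrow> real^3 \<Rightarrow> real^3" where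
  "complement_map A B C = homothety (centroid A B C) (- 1 / 2)"

definition anticomplement_map :: "real^2 \<Rightarrow> real^2 \<Rightarrow> real^2 \<Rightarrow> real^3 \<Rightarrow> real^3" where
  "anticomplement_map A B C = homothety (centroid A B C) (- 2)"

definition from_bary :: "real^2 \<Rightarrow> real^2 \<Rightarrow> real^2 \<Rightarrow> real^3 \<Rightarrow> real^3" where
  "from_bary A B C w = w $ 1 *\<^sub>R hom A + w $ 2 *\<^sub>R hom B + w $ 3 *\<^sub>R hom C"

definition bary :: "real^2 \<Rightarrow> real^2 \<Rightarrow> real^2 \<Rightarrow> real^3 \<Rightarrow> real^3" where
  "bary A B C p = (THE w. from_bary A B C w = p)"

text \<open>
  \<open>(1/x : 1/y : 1/z)\<close> with denominators cleared. In this form the map is also defined on the side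
  lines (away from the vertices), so that the image of the line at infinity is the whole Steiner
  circumellipse.
\<close>

definition isotomic :: "real^2 \<Rightarrow> real^2 \<Rightarrow> real^2 \<Rightarrow> real^3 \<Rightarrow> real^3" where
  "isotomic A B C p = (let w = bary A B C p in
     from_bary A B C (vector [w $ 2 * w $ 3, w $ 3 * w $ 1, w $ 1 * w $ 2]))"

definition on_isotomic_linf :: "real^2 \<Rightarrow> real^2 \<Rightarrow> real^2 \<Rightarrow> real^3 \<Rightarrow> bool" where
  "on_isotomic_linf A B C p \<longleftrightarrow>
     (\<exists>s. s \<noteq> 0 \<and> on s linf \<and> same_point p (isotomic A B C s))"

text \<open>Conics, possibly degenerate, are given by nonzero symmetric matrices.\<close>

definition conic :: "real^3^3 \<Rightarrow> bool" where
  "conic M \<longleftrightarrow> M \<noteq> 0 \<and> transpose M = M"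

definition on_conic :: "real^3 \<Rightarrow> real^3^3 \<Rightarrow> bool" where
  "on_conic p M \<longleftrightarrow> p \<bullet> (M *v p) = 0"

text \<open>
  A pole of \<open>l\<close> is a point conjugate to every point of \<open>l\<close>. For a line pair this is the
  intersection of the two lines, if \<open>l\<close> does not pass through it.
\<close>

definition is_pole :: "real^3^3 \<Rightarrow> real^3 \<Rightarrow> real^3 \<Rightarrow> bool" where
  "is_pole M l z \<longleftrightarrow> z \<noteq> 0 \<and> (\<forall>y. on y l \<longrightarrow> y \<bullet> (M *v z) = 0)"

definition nine_point_conic :: "real^3 \<Rightarrow> real^3 \<Rightarrow> real^3 \<Rightarrow> real^3 \<Rightarrow> real^3 \<Rightarrow> (real^3) set" where
  "nine_point_conic a b c d l =
     {z. \<exists>M. conic M \<and> on_conic a M \<and> on_conic b M \<and> on_conic c M \<and> on_conic d M \<and> is_pole M l z}"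

definition affine_collineation :: "real^3^3 \<Rightarrow> bool" where
  "affine_collineation T \<longleftrightarrow> invertible T \<and> (\<forall>p. on p linf \<longrightarrow> on (T *v p) linf)"

definition cevian_affine_map :: "real^3 \<Rightarrow> real^3 \<Rightarrow> real^3 \<Rightarrow> real^3 \<Rightarrow> real^3^3 \<Rightarrow> bool" where
  "cevian_affine_map a b c p T \<longleftrightarrow> affine_collineation T \<and>
     same_point (T *v a) (meet (join a p) (join b c)) \<and>
     same_point (T *v b) (meet (join b p) (join c a)) \<and>
     same_point (T *v c) (meet (join c p) (join a b))"

text \<open>
  The conic \<open>C\<^sub>O\<close> with tilde, given the point \<open>P' = \<iota>(P)\<close>: the preimage of the nine-point conic under
  the affine map \<open>T\<close>. The matrix \<open>T\<close> is unique up to a nonzero factor.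
\<close>

definition circumconic_O :: "real^3 \<Rightarrow> real^3 \<Rightarrow> real^3 \<Rightarrow> real^3 \<Rightarrow> (real^3) set" where
  "circumconic_O a b c P' =
     {r. \<exists>T. cevian_affine_map a b c P' T \<and> T *v r \<in> nine_point_conic a b c P' linf}"

text \<open>
  The intersection of the line \<open>side\<close> with the parallel to the line \<open>m\<close> through \<open>r\<close>. It is ordinary
  when \<open>r\<close> is ordinary, \<open>side\<close> and \<open>m\<close> are ordinary lines and \<open>m\<close> is not parallel to \<open>side\<close>; this
  applies to \<open>side = BC\<close>, \<open>m = QD\<close>, since \<open>D\<close> is an ordinary point of \<open>BC\<close> and \<open>Q\<close> does not lie on
  \<open>BC\<close> if \<open>P\<close> is not on the sides of the anticomplementary triangle.
\<close>

definition foot :: "real^3 \<Rightarrow> real^3 \<Rightarrow> real^3 \<Rightarrow> real^3" where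
  "foot r side m = meet (parallel_through r m) side"

end

theory Submission
  imports Defs
begin

text \<open>
  In barycentric coordinates with respect to \<open>ABC\<close> let \<open>P = (x : y : z)\<close> and
  \<open>S = x y + y z + z x\<close>. Then \<open>P' = (y z : z x : x y)\<close> and
  \<open>Q = (x (y + z) : y (z + x) : z (x + y))\<close>. Write the point \<open>R\<^sub>1\<close> as
  \<open>((y + z) \<alpha> : (z + x) \<beta> : (x + y) \<gamma>)\<close>. In these coordinates the affine map \<open>T\<close> with
  \<open>A, B, C \<mapsto> D\<^sub>3, E\<^sub>3, F\<^sub>3\<close> is free of denominators, because \<open>D\<^sub>3 = (0 : z : y)\<close> has weight \<open>y + z\<close>:
  it sends \<open>R\<^sub>1\<close> to \<open>(\<beta> z + \<gamma> y : \<alpha> z + \<gamma> x : \<alpha> y + \<beta> x)\<close> (\<open>cevian_affine_map_pt\<close>).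

  A conic through \<open>A, B, C\<close> has an equation \<open>f v w + g w u + h u v = 0\<close>. Passing through \<open>P'\<close> and
  having a given center are three homogeneous linear conditions on \<open>(f, g, h)\<close>, so a nonzero
  solution forces their determinant to vanish. This determinant is a quadratic form \<open>N\<close> in the
  coordinates of the center (\<open>nine_point_conic_pt\<close>), and \<open>R\<^sub>1\<close> on the circumconic means
  \<open>N (T R\<^sub>1) = 0\<close> (\<open>circumconic_O_pt\<close>).

  The coordinates of the feet are linear in \<open>R\<^sub>1\<close>, so the condition that the feet are collinear is
  the vanishing of a cubic form in \<open>R\<^sub>1\<close>. If \<open>R\<^sub>1\<close> is at infinity, then so are all three feet;
  hence the cubic form contains the line at infinity. At \<open>R\<^sub>1 = A\<close> the feet on \<open>CA\<close> and \<open>AB\<close>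
  coincide, and likewise at \<open>B\<close> and \<open>C\<close>; hence the remaining quadratic factor
  is a circumconic. It is a multiple of \<open>N \<circ> T\<close>: the determinant of the feet is
  \<open>2 S x y z\<close> times the weight of \<open>R\<^sub>1\<close> times \<open>N (T R\<^sub>1)\<close> (\<open>feet_determinant\<close>).
\<close>

section \<open>Brackets and collinearity\<close>

definition bracket :: "real^3 \<Rightarrow> real^3 \<Rightarrow> real^3 \<Rightarrow> real" where
  "bracket p q r = p \<bullet> cross3 q r"

lemma cross3_cross3_left:
  "cross3 (cross3 p q) s = (p \<bullet> s) *\<^sub>R q - (q \<bullet> s) *\<^sub>R p"
  by (simp add: cross3_simps forall_3)

lemma hom_nth [simp]: "hom X $ 1 = X $ 1" "hom X $ 2 = X $ 2" "hom X $ 3 = 1"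
  by (simp_all add: hom_def)

lemma inner_linf [simp]: "p \<bullet> linf = p $ 3"
  by (simp add: linf_def inner_vec_def sum_3)

lemma collinear_0_iff_det:
  fixes u v :: "real^2"
  shows "collinear {0, u, v} \<longleftrightarrow> u $ 1 * v $ 2 = u $ 2 * v $ 1"
proof
  assume "collinear {0, u, v}"
  then show "u $ 1 * v $ 2 = u $ 2 * v $ 1"
    by (auto simp: collinear_lemma)
next
  assume det: "u $ 1 * v $ 2 = u $ 2 * v $ 1"
  have "v = (v $ 1 / u $ 1) *\<^sub>R u" if "u $ 1 \<noteq> 0"
    using that det by (simp add: vec_eq_iff forall_2 field_simps)
  moreover have "v = (v $ 2 / u $ 2) *\<^sub>R u" if "u $ 2 \<noteq> 0"
    using that det by (simp add: vec_eq_iff forall_2 field_simps)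
  moreover have "u = 0" if "u $ 1 = 0" "u $ 2 = 0"
    using that by (simp add: vec_eq_iff forall_2)
  ultimately show "collinear {0, u, v}"
    unfolding collinear_lemma by blast
qed

lemma collinear_iff_bracket:
  "collinear {X, Y, Z} \<longleftrightarrow> bracket (hom X) (hom Y) (hom Z) = 0"
proof -
  have "collinear {X, Y, Z} \<longleftrightarrow> collinear {0, X - Y, Z - Y}"
    by (rule collinear_3) simp
  then show ?thesis
    by (auto simp: collinear_0_iff_det bracket_def inner_vec_def sum_3 cross_components algebra_simps)
qed

lemma hom_aff:
  assumes "p $ 3 \<noteq> 0"
  shows "hom (aff p) = (1 / p $ 3) *\<^sub>R p"
  using assms by (simp add: vec_eq_iff forall_3 aff_def)

lemma collinear_aff:
  assumes "p $ 3 \<noteq> 0" "q $ 3 \<noteq> 0" "r $ 3 \<noteq> 0" and "bracket p q r = 0"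
  shows "collinear {aff p, aff q, aff r}"
  using assms unfolding collinear_iff_bracket hom_aff[OF assms(1)] hom_aff[OF assms(2)] hom_aff[OF assms(3)]
  by (simp add: bracket_def cross_mult_left cross_mult_right)

text \<open>
  The intersection of a line \<open>v p\<close> with \<open>side\<close> is the combination of \<open>v\<close> and \<open>p\<close> that annihilates
  \<open>side\<close>. With \<open>v\<close> a vertex and \<open>side\<close> the opposite side this yields the traces of \<open>p\<close>; applied
  twice it yields the feet.
\<close>

lemma meet_join:
  "meet (join v p) side = (v \<bullet> side) *\<^sub>R p - (p \<bullet> side) *\<^sub>R v"
  by (simp add: meet_def join_def cross3_cross3_left)

lemma foot_formula:
  "foot r side m = (r \<bullet> side) *\<^sub>R meet m linf - (meet m linf \<bullet> side) *\<^sub>R r"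
  by (simp add: foot_def parallel_through_def meet_join)

text \<open>The determinant of the three linear equations in \<open>(f, g, h)\<close> in the next lemma.\<close>

definition nine_point_form :: "real \<Rightarrow> real \<Rightarrow> real \<Rightarrow> real \<Rightarrow> real \<Rightarrow> real \<Rightarrow> real" where
  "nine_point_form x y z p q r =
     x * p * (q + r - p) + y * q * (r + p - q) + z * r * (p + q - r)"

text \<open>
  The conic \<open>f v w + g w u + h u v = 0\<close> has the matrix with rows \<open>(0, h, g)\<close>, \<open>(h, 0, f)\<close>,
  \<open>(g, f, 0)\<close> up to a factor. It has center \<open>(p : q : r)\<close> if the matrix maps \<open>(p, q, r)\<close> to a
  multiple of \<open>(1, 1, 1)\<close>, which is the line at infinity; and it contains \<open>(1/x : 1/y : 1/z)\<close>
  if \<open>f x + g y + h z = 0\<close>.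
\<close>

lemma nine_point_form_eq_0:
  assumes pole: "h * q + g * r = h * p + f * r" "h * p + f * r = g * p + f * q"
    and incident: "f * x + g * y + h * z = 0"
    and nontrivial: "f \<noteq> 0 \<or> g \<noteq> 0 \<or> h \<noteq> 0"
  shows "nine_point_form x y z p q r = 0"
proof -
  have "f * nine_point_form x y z p q r = 0" "g * nine_point_form x y z p q r = 0"
    "h * nine_point_form x y z p q r = 0"
    using pole incident unfolding nine_point_form_def by algebra+
  with nontrivial show ?thesis by auto
qed

section \<open>Barycentric coordinates\<close>

locale triangle =
  fixes A B C :: "real^2"
  assumes not_collinear: "\<not> collinear {A, B, C}"
begin

abbreviation pt :: "real \<Rightarrow> real \<Rightarrow> real \<Rightarrow> real^3" where
  "pt u v w \<equiv> from_bary A B C (vector [u, v, w])"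

definition \<Delta> :: real where
  "\<Delta> = bracket (hom A) (hom B) (hom C)"

lemma \<Delta>_nonzero: "\<Delta> \<noteq> 0"
  using not_collinear by (simp add: collinear_iff_bracket \<Delta>_def)

lemma pt_add: "pt u v w + pt u' v' w' = pt (u + u') (v + v') (w + w')"
  by (simp add: from_bary_def algebra_simps)

lemma pt_diff: "pt u v w - pt u' v' w' = pt (u - u') (v - v') (w - w')"
  by (simp add: from_bary_def algebra_simps)

lemma pt_scaleR: "k *\<^sub>R pt u v w = pt (k * u) (k * v) (k * w)"
  by (simp add: from_bary_def algebra_simps)

text \<open>The third coordinate is the weight, so the line at infinity is \<open>u + v + w = 0\<close>.\<close>

lemma pt_weight: "pt u v w $ 3 = u + v + w"
  by (simp add: from_bary_def)

lemma vertex_pt: "hom A = pt 1 0 0" "hom B = pt 0 1 0" "hom C = pt 0 0 1"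
  by (simp_all add: from_bary_def)

lemma pt_side:
  "pt u v w \<bullet> join (hom B) (hom C) = \<Delta> * u"
  "pt u v w \<bullet> join (hom C) (hom A) = \<Delta> * v"
  "pt u v w \<bullet> join (hom A) (hom B) = \<Delta> * w"
  by (simp_all add: from_bary_def \<Delta>_def bracket_def join_def inner_vec_def sum_3
      cross_components algebra_simps)

lemma bracket_pt:
  "bracket (pt u v w) (pt u' v' w') (pt u'' v'' w'') =
     \<Delta> * (u * (v' * w'' - w' * v'') + v * (w' * u'' - u' * w'') + w * (u' * v'' - v' * u''))"
  by (simp add: from_bary_def \<Delta>_def bracket_def inner_vec_def sum_3 cross_components algebra_simps)

lemma pt_eq_iff: "pt u v w = pt u' v' w' \<longleftrightarrow> u = u' \<and> v = v' \<and> w = w'"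
  using pt_side \<Delta>_nonzero by (metis mult_cancel_left)

text \<open>The coordinates come from Cramer's rule.\<close>

lemma pt_exhaust:
  obtains u v w where "p = pt u v w"
proof -
  let ?a = "hom A" and ?b = "hom B" and ?c = "hom C"
  have "\<Delta> *\<^sub>R p = bracket p ?b ?c *\<^sub>R ?a + bracket ?a p ?c *\<^sub>R ?b + bracket ?a ?b p *\<^sub>R ?c"
    by (simp add: \<Delta>_def vec_eq_iff forall_3 bracket_def inner_vec_def sum_3 cross_components
        algebra_simps)
  also have "\<dots> = pt (bracket p ?b ?c) (bracket ?a p ?c) (bracket ?a ?b p)"
    by (simp add: from_bary_def)
  finally have "(1 / \<Delta>) *\<^sub>R (\<Delta> *\<^sub>R p) =
      (1 / \<Delta>) *\<^sub>R pt (bracket p ?b ?c) (bracket ?a p ?c) (bracket ?a ?b p)"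
    by simp
  then show ?thesis
    using \<Delta>_nonzero by (auto simp: pt_scaleR intro: that)
qed

lemma isotomic_pt: "isotomic A B C (pt x y z) = pt (y * z) (z * x) (x * y)"
proof -
  have "bary A B C (pt x y z) = vector [x, y, z]"
    unfolding bary_def
  proof (rule the_equality)
    fix w :: "real^3"
    assume *: "from_bary A B C w = pt x y z"
    have "w = vector [w $ 1, w $ 2, w $ 3]"
      by (simp add: vec_eq_iff forall_3)
    with * show "w = vector [x, y, z]"
      by (metis pt_eq_iff)
  qed simp
  then show ?thesis
    by (simp add: isotomic_def)
qed

lemma hom_centroid: "hom (centroid A B C) = pt (1/3) (1/3) (1/3)"
  by (simp add: from_bary_def centroid_def vec_eq_iff forall_3)

lemma complement_map_pt:
  "complement_map A B C (pt u v w) = (1/2) *\<^sub>R pt (v + w) (w + u) (u + v)"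
  by (simp add: complement_map_def homothety_def hom_centroid pt_weight pt_scaleR pt_add pt_eq_iff
      field_simps)

lemma anticomplement_map_pt:
  "anticomplement_map A B C (pt u v w) = pt (v + w - u) (w + u - v) (u + v - w)"
  by (simp add: anticomplement_map_def homothety_def hom_centroid pt_weight pt_scaleR pt_add
      pt_eq_iff field_simps)

lemma on_sides_pt:
  "on_sides (pt x y z) (hom A) (hom B) (hom C) \<longleftrightarrow> x = 0 \<or> y = 0 \<or> z = 0"
  using \<Delta>_nonzero by (simp add: on_sides_def on_def pt_side)

lemma on_anticomplementary_sides_pt:
  "on_sides (pt x y z) (anticomplement_map A B C (hom A)) (anticomplement_map A B C (hom B))
     (anticomplement_map A B C (hom C)) \<longleftrightarrow> y + z = 0 \<or> z + x = 0 \<or> x + y = 0"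
proof -
  have "on (pt u v w) (join (pt u' v' w') (pt u'' v'' w'')) \<longleftrightarrow>
      u * (v' * w'' - w' * v'') + v * (w' * u'' - u' * w'') + w * (u' * v'' - v' * u'') = 0"
    for u v w u' v' w' u'' v'' w''
    using bracket_pt \<Delta>_nonzero by (simp add: bracket_def on_def join_def)
  then show ?thesis
    by (auto simp: on_sides_def vertex_pt anticomplement_map_pt)
qed

section \<open>The nine-point conic and the circumconic\<close>

text \<open>
  With respect to the basis \<open>hom A, hom B, hom C\<close> the symmetric matrix of a conic through the
  vertices has zero diagonal, so the conic is described by the three off-diagonal entries
  \<open>f, g, h\<close>, and these do not all vanish. The points \<open>A - B\<close> and \<open>B - C\<close> at infinity, conjugate to
  the center, give the two equations for the center.
\<close>

lemma nine_point_conic_pt: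
  assumes P: "x \<noteq> 0" "y \<noteq> 0" "z \<noteq> 0"
    and "pt p q r \<in> nine_point_conic (hom A) (hom B) (hom C) (pt (y * z) (z * x) (x * y)) linf"
  shows "nine_point_form x y z p q r = 0"
proof -
  from assms(4) obtain M where M: "M \<noteq> 0" "transpose M = M"
    and on: "on_conic (hom A) M" "on_conic (hom B) M" "on_conic (hom C) M"
      "on_conic (pt (y * z) (z * x) (x * y)) M"
    and pole: "is_pole M linf (pt p q r)"
    by (auto simp: nine_point_conic_def conic_def)
  define f g h where "f = hom B \<bullet> (M *v hom C)" and "g = hom C \<bullet> (M *v hom A)"
    and "h = hom A \<bullet> (M *v hom B)"
  have sym: "v \<bullet> (M *v w) = w \<bullet> (M *v v)" for v w
    by (metis M(2) dot_lmul_matrix inner_commute transpose_matrix_vector)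
  have form: "pt u v w \<bullet> (M *v pt u' v' w') =
      f * (v * w' + w * v') + g * (w * u' + u * w') + h * (u * v' + v * u')" for u v w u' v' w'
    using on(1-3) sym[of "hom C" "hom B"] sym[of "hom A" "hom C"] sym[of "hom B" "hom A"]
    by (simp add: from_bary_def f_def g_def h_def on_conic_def inner_add_left inner_add_right
        matrix_vector_right_distrib matrix_vector_mult_scaleR algebra_simps)
  have nontrivial: "f \<noteq> 0 \<or> g \<noteq> 0 \<or> h \<noteq> 0"
  proof (rule ccontr)
    assume "\<not> ?thesis"
    then have "v \<bullet> (M *v w) = 0" for v w
      by (metis form pt_exhaust mult_zero_left add_0)
    then have "M *v w = 0 *v w" for w
      by (metis inner_eq_zero_iff matrix_vector_mult_0)
    with M(1) show False
      by (metis matrix_eq)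
  qed
  have conj: "pt u v w \<bullet> (M *v pt p q r) = 0" if "u + v + w = 0" for u v w
    using pole that by (simp add: is_pole_def on_def pt_weight)
  have eqs: "h * q + g * r = h * p + f * r" "h * p + f * r = g * p + f * q"
    using conj[of 1 "-1" 0] conj[of 0 1 "-1"] by (simp_all add: form algebra_simps)
  have "2 * (x * y * z) * (f * x + g * y + h * z) = 0"
    using on(4) by (simp add: on_conic_def form algebra_simps)
  with P have "f * x + g * y + h * z = 0"
    by simp
  from nine_point_form_eq_0[OF eqs this nontrivial] show ?thesis .
qed

text \<open>
  A collineation is determined by the images of the vertices only up to one factor for each vertex.
  Since an affine one sends \<open>A - B\<close> and \<open>A - C\<close> to points at infinity, the representatives of the
  images of \<open>A, B, C\<close> have equal weights. Their multiples \<open>(0, z, y)\<close>, \<open>(z, 0, x)\<close>, \<open>(y, x, 0)\<close> have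
  weights \<open>y + z\<close>, \<open>z + x\<close>, \<open>x + y\<close>; the factors in the coordinates of the argument cancel these.
\<close>

lemma cevian_affine_map_pt:
  assumes P: "x \<noteq> 0" "y \<noteq> 0" "z \<noteq> 0"
    and ordinary: "y + z \<noteq> 0" "z + x \<noteq> 0" "x + y \<noteq> 0"
    and T: "cevian_affine_map (hom A) (hom B) (hom C) (pt (y * z) (z * x) (x * y)) T"
  obtains k where "k \<noteq> 0"
    and "\<And>\<alpha> \<beta> \<gamma>. T *v pt ((y + z) * \<alpha>) ((z + x) * \<beta>) ((x + y) * \<gamma>) =
      k *\<^sub>R pt (\<beta> * z + \<gamma> * y) (\<alpha> * z + \<gamma> * x) (\<alpha> * y + \<beta> * x)"
proof -
  let ?P' = "pt (y * z) (z * x) (x * y)"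
  have image: "\<exists>l. l \<noteq> 0 \<and> v = l *\<^sub>R d" if "same_point v (k *\<^sub>R d)" "k \<noteq> 0" for v d k
  proof -
    from that obtain c where c: "k *\<^sub>R d = c *\<^sub>R v" "k *\<^sub>R d \<noteq> 0"
      unfolding same_point_def by blast
    then have "c \<noteq> 0" by auto
    then have "v = (k / c) *\<^sub>R d"
      by (metis c(1) divideR_right divide_inverse_commute scaleR_scaleR)
    with \<open>c \<noteq> 0\<close> that(2) show ?thesis
      by (intro exI[of _ "k / c"]) auto
  qed
  have "meet (join (hom A) ?P') (join (hom B) (hom C)) = (\<Delta> * x) *\<^sub>R pt 0 z y"
    "meet (join (hom B) ?P') (join (hom C) (hom A)) = (\<Delta> * y) *\<^sub>R pt z 0 x"
    "meet (join (hom C) ?P') (join (hom A) (hom B)) = (\<Delta> * z) *\<^sub>R pt y x 0"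
    unfolding meet_join
    by (simp_all add: vertex_pt pt_side[unfolded vertex_pt] pt_scaleR pt_diff pt_eq_iff)
  with T image P \<Delta>_nonzero obtain l m n where l: "l \<noteq> 0" and
    images: "T *v hom A = l *\<^sub>R pt 0 z y" "T *v hom B = m *\<^sub>R pt z 0 x" "T *v hom C = n *\<^sub>R pt y x 0"
    unfolding cevian_affine_map_def by (metis mult_eq_0_iff)
  have "(T *v (v - w)) $ 3 = 0" if "v $ 3 = w $ 3" for v w
    using T that by (simp add: cevian_affine_map_def affine_collineation_def on_def)
  from this[of "hom A" "hom B"] this[of "hom A" "hom C"]
  have weights: "m * (z + x) = l * (y + z)" "n * (x + y) = l * (y + z)"
    by (simp_all add: matrix_vector_mult_diff_distrib images pt_weight pt_scaleR algebra_simps)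
  show ?thesis
  proof (rule that)
    show "l * (y + z) \<noteq> 0"
      using l ordinary by simp
  next
    fix \<alpha> \<beta> \<gamma>
    let ?X = "y + z" and ?Y = "z + x" and ?Z = "x + y"
    have "T *v pt (?X * \<alpha>) (?Y * \<beta>) (?Z * \<gamma>) =
        (?X * \<alpha>) *\<^sub>R (T *v hom A) + (?Y * \<beta>) *\<^sub>R (T *v hom B) + (?Z * \<gamma>) *\<^sub>R (T *v hom C)"
      by (simp add: from_bary_def matrix_vector_right_distrib matrix_vector_mult_scaleR)
    also have "\<dots> = \<alpha> *\<^sub>R (l * ?X) *\<^sub>R pt 0 z y + \<beta> *\<^sub>R (m * ?Y) *\<^sub>R pt z 0 x
        + \<gamma> *\<^sub>R (n * ?Z) *\<^sub>R pt y x 0"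
      by (simp add: images mult_ac)
    also have "\<dots> = (l * ?X) *\<^sub>R pt (\<beta> * z + \<gamma> * y) (\<alpha> * z + \<gamma> * x) (\<alpha> * y + \<beta> * x)"
      unfolding weights by (simp add: pt_scaleR pt_add pt_eq_iff algebra_simps)
    finally show "T *v pt (?X * \<alpha>) (?Y * \<beta>) (?Z * \<gamma>) =
        (l * ?X) *\<^sub>R pt (\<beta> * z + \<gamma> * y) (\<alpha> * z + \<gamma> * x) (\<alpha> * y + \<beta> * x)" .
  qed
qed

lemma circumconic_O_pt:
  assumes P: "x \<noteq> 0" "y \<noteq> 0" "z \<noteq> 0"
    and ordinary: "y + z \<noteq> 0" "z + x \<noteq> 0" "x + y \<noteq> 0"
    and R: "pt ((y + z) * \<alpha>) ((z + x) * \<beta>) ((x + y) * \<gamma>)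
      \<in> circumconic_O (hom A) (hom B) (hom C) (pt (y * z) (z * x) (x * y))"
  shows "nine_point_form x y z (\<beta> * z + \<gamma> * y) (\<alpha> * z + \<gamma> * x) (\<alpha> * y + \<beta> * x) = 0"
    (is "nine_point_form x y z ?p ?q ?r = 0")
proof -
  from R obtain T where
    T: "cevian_affine_map (hom A) (hom B) (hom C) (pt (y * z) (z * x) (x * y)) T"
    and image: "T *v pt ((y + z) * \<alpha>) ((z + x) * \<beta>) ((x + y) * \<gamma>)
      \<in> nine_point_conic (hom A) (hom B) (hom C) (pt (y * z) (z * x) (x * y)) linf"
    by (auto simp: circumconic_O_def)
  obtain k where "k \<noteq> 0"
    and k: "T *v pt ((y + z) * \<alpha>) ((z + x) * \<beta>) ((x + y) * \<gamma>) = k *\<^sub>R pt ?p ?q ?r"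
    using cevian_affine_map_pt[OF P ordinary T] by metis
  from image have "nine_point_form x y z (k * ?p) (k * ?q) (k * ?r) = 0"
    unfolding k pt_scaleR by (rule nine_point_conic_pt[OF P])
  then have "k\<^sup>2 * nine_point_form x y z ?p ?q ?r = 0"
    unfolding nine_point_form_def by algebra
  with \<open>k \<noteq> 0\<close> show ?thesis by simp
qed

section \<open>The three feet\<close>

text \<open>
  The points \<open>Q\<close> and \<open>D = (0 : y : z)\<close> have weights \<open>S\<close> and \<open>y + z\<close>, so \<open>QD\<close> has direction
  \<open>S D - (y + z) Q\<close>, and the foot on \<open>BC\<close> is the combination of \<open>R\<close> and this direction with first
  coordinate \<open>0\<close>. The factor \<open>y + z\<close> splits off since \<open>S + y\<^sup>2 = (x + y) (y + z)\<close> and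
  \<open>S + z\<^sup>2 = (y + z) (z + x)\<close>.
\<close>

lemma feet_pt:
  fixes x y z \<alpha> \<beta> \<gamma> :: real
  defines "S \<equiv> x * y + y * z + z * x"
    and "P \<equiv> pt x y z"
    and "Q \<equiv> (1/2) *\<^sub>R pt (x * (y + z)) (y * (z + x)) (z * (x + y))"
    and "R \<equiv> pt ((y + z) * \<alpha>) ((z + x) * \<beta>) ((x + y) * \<gamma>)"
    and "a \<equiv> hom A" and "b \<equiv> hom B" and "c \<equiv> hom C"
  shows "foot R (join b c) (join Q (meet (join a P) (join b c))) = (\<Delta>\<^sup>2 * (y + z) / 2) *\<^sub>R
      pt 0 (\<alpha> * y * (S - z\<^sup>2) + \<beta> * x * (S + z\<^sup>2)) (\<alpha> * z * (S - y\<^sup>2) + \<gamma> * x * (S + y\<^sup>2))"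
    and "foot R (join c a) (join Q (meet (join b P) (join c a))) = (\<Delta>\<^sup>2 * (z + x) / 2) *\<^sub>R
      pt (\<beta> * x * (S - z\<^sup>2) + \<alpha> * y * (S + z\<^sup>2)) 0 (\<beta> * z * (S - x\<^sup>2) + \<gamma> * y * (S + x\<^sup>2))"
    and "foot R (join a b) (join Q (meet (join c P) (join a b))) = (\<Delta>\<^sup>2 * (x + y) / 2) *\<^sub>R
      pt (\<gamma> * x * (S - y\<^sup>2) + \<alpha> * z * (S + y\<^sup>2)) (\<gamma> * y * (S - x\<^sup>2) + \<beta> * z * (S + x\<^sup>2)) 0"
  unfolding P_def Q_def R_def a_def b_def c_def S_def foot_formula meet_join inner_linf
  by (simp_all add: vertex_pt pt_side[unfolded vertex_pt] pt_scaleR pt_diff pt_weight pt_eq_iff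
      field_simps power2_eq_square)

text \<open>
  As a cubic form in \<open>R\<^sub>1\<close> the determinant of the feet splits into the weight of \<open>R\<^sub>1\<close>, that is, the
  line at infinity, and the equation of the circumconic.
\<close>

lemma feet_determinant:
  fixes x y z \<alpha> \<beta> \<gamma> :: real
  defines "S \<equiv> x * y + y * z + z * x"
  shows "bracket
      (pt 0 (\<alpha> * y * (S - z\<^sup>2) + \<beta> * x * (S + z\<^sup>2)) (\<alpha> * z * (S - y\<^sup>2) + \<gamma> * x * (S + y\<^sup>2)))
      (pt (\<beta> * x * (S - z\<^sup>2) + \<alpha> * y * (S + z\<^sup>2)) 0 (\<beta> * z * (S - x\<^sup>2) + \<gamma> * y * (S + x\<^sup>2)))
      (pt (\<gamma> * x * (S - y\<^sup>2) + \<alpha> * z * (S + y\<^sup>2)) (\<gamma> * y * (S - x\<^sup>2) + \<beta> * z * (S + x\<^sup>2)) 0)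
    = \<Delta> * (2 * S * x * y * z * ((y + z) * \<alpha> + (z + x) * \<beta> + (x + y) * \<gamma>)) *
      nine_point_form x y z (\<beta> * z + \<gamma> * y) (\<alpha> * z + \<gamma> * x) (\<alpha> * y + \<beta> * x)"
  unfolding bracket_pt nine_point_form_def S_def by algebra

end

theorem theorem3p7:
  fixes A B C R\<^sub>1 :: "real^2"
    and a b c P P' Q D E F D\<^sub>1 E\<^sub>1 F\<^sub>1 :: "real^3"
  assumes triangle: "\<not> collinear {A, B, C}"
    and vertices: "a = hom A" "b = hom B" "c = hom C"
    and P: "P \<noteq> 0" "\<not> on_sides P a b c"
      "\<not> on_sides P (anticomplement_map A B C a) (anticomplement_map A B C b)
          (anticomplement_map A B C c)"
    and P': "P' = isotomic A B C P"
    and Q: "Q = complement_map A B C P'"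
    and traces: "D = meet (join a P) (join b c)"
      "E = meet (join b P) (join c a)"
      "F = meet (join c P) (join a b)"
    and not_Steiner: "\<not> on_isotomic_linf A B C P"
    and R\<^sub>1: "hom R\<^sub>1 \<in> circumconic_O a b c P'"
    and feet: "D\<^sub>1 = foot (hom R\<^sub>1) (join b c) (join Q D)"
      "E\<^sub>1 = foot (hom R\<^sub>1) (join c a) (join Q E)"
      "F\<^sub>1 = foot (hom R\<^sub>1) (join a b) (join Q F)"
  shows "collinear {aff D\<^sub>1, aff E\<^sub>1, aff F\<^sub>1}"
proof -
  interpret triangle A B C
    by unfold_locales (rule triangle)
  obtain x y z where P_pt: "P = pt x y z"
    by (rule pt_exhaust)
  obtain u v w where R_pt: "hom R\<^sub>1 = pt u v w"
    by (rule pt_exhaust)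
  have nonzero: "x \<noteq> 0" "y \<noteq> 0" "z \<noteq> 0"
    using P(2) by (auto simp: P_pt vertices on_sides_pt)
  have ordinary: "y + z \<noteq> 0" "z + x \<noteq> 0" "x + y \<noteq> 0"
    using P(3) by (auto simp: P_pt vertices on_anticomplementary_sides_pt)
  have P'_pt: "P' = pt (y * z) (z * x) (x * y)"
    by (simp add: P' P_pt isotomic_pt)
  have Q_pt: "Q = (1/2) *\<^sub>R pt (x * (y + z)) (y * (z + x)) (z * (x + y))"
    by (simp add: Q P'_pt complement_map_pt algebra_simps)
  define \<alpha> \<beta> \<gamma> where "\<alpha> = u / (y + z)" and "\<beta> = v / (z + x)" and "\<gamma> = w / (x + y)"
  have R_weights: "hom R\<^sub>1 = pt ((y + z) * \<alpha>) ((z + x) * \<beta>) ((x + y) * \<gamma>)"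
    using ordinary by (simp add: R_pt \<alpha>_def \<beta>_def \<gamma>_def)
  then have total: "(y + z) * \<alpha> + (z + x) * \<beta> + (x + y) * \<gamma> = 1"
    by (metis hom_nth(3) pt_weight)
  define S where "S = x * y + y * z + z * x"
  define D' E' F' where
    "D' = pt 0 (\<alpha> * y * (S - z\<^sup>2) + \<beta> * x * (S + z\<^sup>2)) (\<alpha> * z * (S - y\<^sup>2) + \<gamma> * x * (S + y\<^sup>2))"
    and "E' = pt (\<beta> * x * (S - z\<^sup>2) + \<alpha> * y * (S + z\<^sup>2)) 0 (\<beta> * z * (S - x\<^sup>2) + \<gamma> * y * (S + x\<^sup>2))"
    and "F' = pt (\<gamma> * x * (S - y\<^sup>2) + \<alpha> * z * (S + y\<^sup>2)) (\<gamma> * y * (S - x\<^sup>2) + \<beta> * z * (S + x\<^sup>2)) 0"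
  have feet': "D\<^sub>1 = (\<Delta>\<^sup>2 * (y + z) / 2) *\<^sub>R D'" "E\<^sub>1 = (\<Delta>\<^sup>2 * (z + x) / 2) *\<^sub>R E'"
    "F\<^sub>1 = (\<Delta>\<^sup>2 * (x + y) / 2) *\<^sub>R F'"
    unfolding feet traces vertices P_pt Q_pt R_weights D'_def E'_def F'_def S_def by (fact feet_pt)+
  \<comment> \<open>The feet are ordinary, so that \<open>aff\<close> does not divide by zero.\<close>
  have "D' $ 3 = x * (y + z) * ((y + z) * \<alpha> + (z + x) * \<beta> + (x + y) * \<gamma>)"
    "E' $ 3 = y * (z + x) * ((y + z) * \<alpha> + (z + x) * \<beta> + (x + y) * \<gamma>)"
    "F' $ 3 = z * (x + y) * ((y + z) * \<alpha> + (z + x) * \<beta> + (x + y) * \<gamma>)"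
    unfolding D'_def E'_def F'_def pt_weight S_def by algebra+
  with total have weights: "D' $ 3 \<noteq> 0" "E' $ 3 \<noteq> 0" "F' $ 3 \<noteq> 0"
    using nonzero ordinary by auto
  have "nine_point_form x y z (\<beta> * z + \<gamma> * y) (\<alpha> * z + \<gamma> * x) (\<alpha> * y + \<beta> * x) = 0"
    using R\<^sub>1 unfolding vertices P'_pt R_weights by (rule circumconic_O_pt[OF nonzero ordinary])
  then have "bracket D' E' F' = 0"
    unfolding D'_def E'_def F'_def S_def feet_determinant by simp
  then have "bracket D\<^sub>1 E\<^sub>1 F\<^sub>1 = 0"
    by (simp add: feet' bracket_def cross_mult_left cross_mult_right)
  with weights show ?thesis
    using \<Delta>_nonzero ordinary by (intro collinear_aff) (simp_all add: feet')
qed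

end
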